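(* Consider the aggregative game with players $\mathcal N=\{1,\dots,N\}$, strategy sets $K_i\subset\mathbb R^n$ and cost functions $f_i$, with the maps $F_i$, $\phi$, the sets $K=\prod_i K_i$, $\bar K=\sum_i K_i$, and the synchronous algorithm, all as defined in the context. Assume: (1) each $K_i$ is nonempty, compact and convex; each $f_i(x_i,u)$ is continuously differentiable in $(x_i,u)$ over some open set containing $K_i\times\bar K$; and each function $x_i\mapsto f_i(x_i,\bar x)$, with $\bar x=x_i+\sum_{j\ne i}x_j$, is convex over $K_i$; (2) $\phi$ is strictly monotone over $K$: $(\phi(x)-\phi(x'))^T(x-x')>0$ for all $x,x'\in K$ with $x\ne x'$; (3) each $F_i(x_i,u)$ is uniformly Lipschitz continuous in $u$ over $\bar K$ for every fixed $x_i\in K_i$: for some $\bar L_i>0$, $\|F_i(x_i,z_1)-F_i(x_i,z_2)\|\le \bar L_i\|z_1-z_2\|$ for all $x_i\in K_i$ and all $z_1,z_2\in\bar K$; (4) there is an integer $Q\ge1$ such that the graph $(\mathcal N,\bigcup_{\ell=1}^{Q}\mathcal E_{\ell+k})$ is connected for all $k\ge0$; (5) there is $\delta>0$ such that for all $i\in\mathcal N$ and $k\ge0$: $w_{ij}(k)\ge\delta$ for $j\in\mathcal N_i(k)$ and $w_{ij}(k)=0$ for $j\notin\mathcal N_i(k)$; $\sum_{j=1}^N w_{ij}(k)=1$ for all $i$; and $\sum_{i=1}^N w_{ij}(k)=1$ for all $j$; (6) the positive stepsizes satisfy $\alpha_{k+1}\le\alpha_k$ for all $k$, $\sum_{k=0}^\infty\alpha_k=\infty$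 and $\sum_{k=0}^\infty\alpha_k^2<\infty$. Then the sequence $x^k=(x_1^k,\dots,x_N^k)$ generated by the synchronous algorithm converges to the (unique) solution $x^*$ of the variational inequality VI$(K,\phi)$, i.e. the unique $x^*\in K$ with $(x-x^* )^T\phi(x^* )\ge0$ for all $x\in K$.
   Context: Game: given $\bar x_{-i}=\sum_{j\ne i}x_j$, player $i$ minimizes $f_i(x_i,x_i+\bar x_{-i})$ over $x_i\in K_i$. Notation: $\bar x=\sum_{j=1}^N x_j$; $\bar K=\sum_{i=1}^N K_i$ is the Minkowski sum; $K=\prod_{i=1}^N K_i$; $F_i(x_i,\bar x)=\nabla_{x_i}f_i(x_i,\bar x)$ is the gradient with respect to $x_i$ of $x_i\mapsto f_i(x_i,x_i+\bar x_{-i})$, i.e. $F_i(x_i,u)=\nabla_1 f_i(x_i,u)+\nabla_2 f_i(x_i,u)$ as a function of two independent arguments; $\phi(x)=(F_1(x_1,\bar x)^T,\dots,F_N(x_N,\bar x)^T)^T$. $\Pi_{K_i}$ is Euclidean projection onto $K_i$; $\|\cdot\|$ is the Euclidean norm. Network: for each $k\ge0$, $\mathcal G_k=(\mathcal N,\mathcal E_k)$ is an undirected graph, $\mathcal N_i(k)=\{j:\{i,j\}\in\mathcal E_k\}$, with the convention $i\in\mathcal N_i(k)$ for all $i,k$. $W(k)=[w_{ij}(k)]$ is a nonnegative $N\times N$ weight matrix. Synchronous algorithm: start from $x_i^0\in K_i$ and $v_i^0=x_i^0$. For $k\ge0$ and all $i$, $$\hat v_i^k=\sum_{j=1}^N w_{ij}(k)v_j^k,\qquad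 x_i^{k+1}=\Pi_{K_i}[x_i^k-\alpha_kF_i(x_i^k,N\hat v_i^k)],\qquad v_i^{k+1}=\hat v_i^k+x_i^{k+1}-x_i^k.$$
   Formalization: Added hypothesis: for each i the closure of the points (x_i^k, N v̂_i^k) lies in the open set where f_i is continuously differentiable. N v̂_i^k may leave K̄, where F_i is uncontrolled and the claim fails; the condition is automatic if f_i is C^1 near K_i×R^n or N v̂_i^k stays in K̄. *)

theory Defs
  imports "HOL-Analysis.Analysis"
begin

text \<open>
  Players form a finite type \<open>'p\<close> (so \<open>N = CARD('p)\<close>), strategies are vectors in \<open>real ^ 'n\<close>, and
  strategy profiles are elements of \<open>(real ^ 'n) ^ 'p\<close>, whose inner product and norm are the
  Euclidean ones of the stacked vectors.
\<close>

definition grad :: "('a::real_inner \<Rightarrow> real) \<Rightarrow> 'a \<Rightarrow> 'a" where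
  "grad g a = (THE d. GDERIV g a :> d)"

lemma grad_eqI:
  assumes "GDERIV g a :> d"
  shows "grad g a = d"
proof -
  have "e = d" if "GDERIV g a :> e" for e
  proof -
    have "(\<lambda>h. h \<bullet> e) = (\<lambda>h. h \<bullet> d)"
      using that assms unfolding gderiv_def by (rule has_derivative_unique)
    then have "(e - d) \<bullet> e = (e - d) \<bullet> d"
      by meson
    then show ?thesis
      by (metis inner_diff_right inner_eq_zero_iff right_minus_eq)
  qed
  with assms show ?thesis
    unfolding grad_def by blast
qed

definition continuously_differentiable_on :: "('a::real_inner \<Rightarrow> real) \<Rightarrow> 'a set \<Rightarrow> bool" where
  "continuously_differentiable_on g S \<longleftrightarrow>
    (\<exists>g'. continuous_on S g' \<and> (\<forall>a\<in>S. GDERIV g a :> g' a))"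

definition profiles :: "('p::finite \<Rightarrow> (real ^ 'n) set) \<Rightarrow> ((real ^ 'n) ^ 'p) set" where
  "profiles K = {x. \<forall>i. x $ i \<in> K i}"

text \<open>The Minkowski sum of the strategy sets, using the addition of sets.\<close>

definition aggregates :: "('p::finite \<Rightarrow> (real ^ 'n) set) \<Rightarrow> (real ^ 'n) set" where
  "aggregates K = (\<Sum>i\<in>UNIV. K i)"

text \<open>
  For the cost \<open>g\<close> of one player: the gradient of \<open>y \<mapsto> g y (y + s)\<close> at \<open>y\<close>, as a function of
  \<open>y\<close> and \<open>u = y + s\<close>. It has no meaning at points where \<open>g\<close> is not differentiable.
\<close>

definition grad_map :: "(real ^ 'n \<Rightarrow> real ^ 'n \<Rightarrow> real) \<Rightarrow> real ^ 'n \<Rightarrow> real ^ 'n \<Rightarrow> real ^ 'n" where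
  "grad_map g y u = grad (\<lambda>z. g z u) y + grad (\<lambda>w. g y w) u"

definition game_map ::
    "('p::finite \<Rightarrow> real ^ 'n \<Rightarrow> real ^ 'n \<Rightarrow> real) \<Rightarrow> (real ^ 'n) ^ 'p \<Rightarrow> (real ^ 'n) ^ 'p" where
  "game_map f x = (\<chi> i. grad_map (f i) (x $ i) (\<Sum>j\<in>UNIV. x $ j))"

definition strictly_monotone_over :: "'a::real_inner set \<Rightarrow> ('a \<Rightarrow> 'a) \<Rightarrow> bool" where
  "strictly_monotone_over S \<phi> \<longleftrightarrow>
    (\<forall>x\<in>S. \<forall>x'\<in>S. x \<noteq> x' \<longrightarrow> (\<phi> x - \<phi> x') \<bullet> (x - x') > 0)"

definition solves_VI :: "'a::real_inner set \<Rightarrow> ('a \<Rightarrow> 'a) \<Rightarrow> 'a \<Rightarrow> bool" where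
  "solves_VI S \<phi> a \<longleftrightarrow> a \<in> S \<and> (\<forall>x\<in>S. (x - a) \<bullet> \<phi> a \<ge> 0)"

text \<open>Undirected graphs on \<open>UNIV :: 'p set\<close> are given by their edge sets; loops are immaterial.\<close>

definition undirected_edges :: "'p set set \<Rightarrow> bool" where
  "undirected_edges E \<longleftrightarrow> (\<forall>e\<in>E. \<exists>i j. e = {i, j})"

definition graph_connected :: "'p set set \<Rightarrow> bool" where
  "graph_connected E \<longleftrightarrow> (\<forall>i j. (i, j) \<in> {(a, b). {a, b} \<in> E}\<^sup>*)"

definition neighbours :: "'p set set \<Rightarrow> 'p \<Rightarrow> 'p set" where
  "neighbours E i = insert i {j. {i, j} \<in> E}"

definition mixed_estimate :: "real ^ 'p ^ 'p \<Rightarrow> (real ^ 'n) ^ 'p \<Rightarrow> 'p::finite \<Rightarrow> real ^ 'n" where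
  "mixed_estimate W v i = (\<Sum>j\<in>UNIV. W $ i $ j *\<^sub>R v $ j)"

definition synchronous_algorithm ::
    "('p::finite \<Rightarrow> (real ^ 'n) set) \<Rightarrow> ('p \<Rightarrow> real ^ 'n \<Rightarrow> real ^ 'n \<Rightarrow> real) \<Rightarrow>
     (nat \<Rightarrow> real ^ 'p ^ 'p) \<Rightarrow> (nat \<Rightarrow> real) \<Rightarrow>
     (nat \<Rightarrow> (real ^ 'n) ^ 'p) \<Rightarrow> (nat \<Rightarrow> (real ^ 'n) ^ 'p) \<Rightarrow> bool" where
  "synchronous_algorithm K f W \<alpha> x v \<longleftrightarrow>
    (\<forall>i. x 0 $ i \<in> K i \<and> v 0 $ i = x 0 $ i) \<and>
    (\<forall>k i.
      x (Suc k) $ i =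
        closest_point (K i)
          (x k $ i - \<alpha> k *\<^sub>R
            grad_map (f i) (x k $ i) (real CARD('p) *\<^sub>R mixed_estimate (W k) (v k) i)) \<and>
      v (Suc k) $ i = mixed_estimate (W k) (v k) i + x (Suc k) $ i - x k $ i)"

text \<open>
  Write \<open>V\<^sub>i\<close> for the mixed estimate of player \<open>i\<close>.
  The vectors \<open>N V\<^sub>i\<close> need not lie in the Minkowski sum of the strategy sets, so the algorithm may
  evaluate \<open>grad_map (f i)\<close> away from the set on which the costs are known to be differentiable. The algorithm
  is well posed if all evaluation points \<open>(x\<^sub>i, N V\<^sub>i)\<close> of each player \<open>i\<close> lie in the domain \<open>D i\<close> of
  smoothness of its cost and do not accumulate at the boundary of \<open>D i\<close>.
\<close>

definition well_posed_run ::
    "('p::finite \<Rightarrow> ((real ^ 'n) \<times> (real ^ 'n)) set) \<Rightarrow> (nat \<Rightarrow> real ^ 'p ^ 'p) \<Rightarrow>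
     (nat \<Rightarrow> (real ^ 'n) ^ 'p) \<Rightarrow> (nat \<Rightarrow> (real ^ 'n) ^ 'p) \<Rightarrow> bool" where
  "well_posed_run D W x v \<longleftrightarrow>
    (\<forall>i. closure (range (\<lambda>k. (x k $ i, real CARD('p) *\<^sub>R mixed_estimate (W k) (v k) i))) \<subseteq> D i)"

text \<open>
  Well-posedness is automatic if the costs are smooth near \<open>K i \<times> UNIV\<close>, and also if the vectors
  \<open>N V\<^sub>i\<close> never leave the Minkowski sum: take \<open>U = UNIV\<close> or \<open>U = aggregates K\<close> below.
\<close>

lemma well_posed_runI:
  fixes K :: "'p::finite \<Rightarrow> (real ^ 'n) set"
  assumes K: "\<And>i. closed (K i)" "\<And>i. K i \<noteq> {}"
    and U: "closed U" "\<And>i. K i \<times> U \<subseteq> D i"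
    and alg: "synchronous_algorithm K f W \<alpha> x v"
    and mem: "\<And>k i. real CARD('p) *\<^sub>R mixed_estimate (W k) (v k) i \<in> U"
  shows "well_posed_run D W x v"
proof -
  have "x k $ i \<in> K i" for k i
    using alg closest_point_in_set[OF K]
    by (cases k) (auto simp: synchronous_algorithm_def)
  then have "range (\<lambda>k. (x k $ i, real CARD('p) *\<^sub>R mixed_estimate (W k) (v k) i)) \<subseteq> K i \<times> U" for i
    using mem by auto
  then have "closure (range (\<lambda>k. (x k $ i, real CARD('p) *\<^sub>R mixed_estimate (W k) (v k) i)))
      \<subseteq> K i \<times> U" for i
    by (intro closure_minimal closed_Times K U)
  with U(2) show ?thesis
    unfolding well_posed_run_def by blast
qed

end

theory Submission
  imports Defs
begin

text \<open>
  Doubly stochastic weights preserve the sum of the \<open>v\<^sub>i\<close>, so \<open>\<Sum> v\<^sub>i = \<Sum> x\<^sub>i\<close>, and over a fixed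
  number of steps they contract the spread of the \<open>v\<^sub>i\<close> by a constant factor. Since the \<open>x\<^sub>i\<close> stay in
  compact sets, the spread is bounded, and the evaluation points \<open>(x\<^sub>i, N V\<^sub>i)\<close> stay in a compact set
  on which \<open>F\<^sub>i\<close> is bounded and uniformly continuous. Hence steps have size \<open>O(\<alpha>\<^sub>k)\<close>, the spread tends
  to 0, and the algorithm is the projection method for the variational inequality with errors
  tending to 0. By strict monotonicity and compactness \<open>(\<phi> x - \<phi> x\<^sup>*) \<bullet> (x - x\<^sup>*)\<close> is bounded below
  by a positive constant away from the solution \<open>x\<^sup>*\<close>. There the errors eventually cannot compensate
  the decrease of \<open>\<parallel>x - x\<^sup>*\<parallel>\<^sup>2\<close>, and \<open>\<Sum> \<alpha>\<^sub>k = \<infinity>\<close> drives the iterates into every neighbourhood of \<open>x\<^sup>*\<close>.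
\<close>

section \<open>Averaging over time-varying graphs\<close>

text \<open>The oscillation serves instead of the distance to the mean because row sums alone make
  it contract. Vector estimates are treated one coordinate at a time.\<close>

definition spread :: "('p::finite \<Rightarrow> real) \<Rightarrow> real" where
  "spread z = Max (range z) - Min (range z)"

lemma spread_diff_le: "z i - z j \<le> spread z"
  unfolding spread_def by (intro diff_mono) auto

lemma spread_leI:
  assumes "\<And>i. z i \<le> b" "\<And>i. a \<le> z i"
  shows "spread z \<le> b - a"
  unfolding spread_def by (intro diff_mono) (auto simp: assms)

lemma spread_nonneg: "0 \<le> spread z"
  using spread_diff_le[of z undefined undefined] by simp

locale averaging =
  fixes E :: "nat \<Rightarrow> 'p::finite set set"
    and W :: "nat \<Rightarrow> real ^ 'p ^ 'p"
    and \<delta> :: real and Q :: nat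
  assumes connected: "\<And>k. graph_connected (\<Union>l\<in>{1..Q}. E (l + k))"
    and \<delta>_pos: "\<delta> > 0"
    and W_nonneg: "\<And>k i j. W k $ i $ j \<ge> 0"
    and W_ge: "\<And>k i j. j \<in> neighbours (E k) i \<Longrightarrow> W k $ i $ j \<ge> \<delta>"
    and W_row: "\<And>k i. (\<Sum>j\<in>UNIV. W k $ i $ j) = 1"
begin

text \<open>One block of steps per player. The last graph in the window at \<open>k\<close> is
  \<open>E (Q + k)\<close>, and its effect shows at time \<open>k + Q + 1\<close>; hence blocks of
  length \<open>Suc Q\<close>.\<close>

definition horizon :: nat where "horizon = CARD('p) * Suc Q"

lemma W_self: "W k $ i $ i \<ge> \<delta>"
  by (rule W_ge) (simp add: neighbours_def)

lemma \<delta>_le_1: "\<delta> \<le> 1"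
proof -
  have "\<delta> \<le> W 0 $ undefined $ undefined"
    by (rule W_self)
  also have "\<dots> \<le> (\<Sum>j\<in>UNIV. W 0 $ undefined $ j)"
    by (rule member_le_sum) (auto simp: W_nonneg)
  finally show ?thesis
    by (simp add: W_row)
qed

lemma average_le:
  assumes "\<And>j. z j \<le> b"
  shows "(\<Sum>j\<in>UNIV. W k $ i $ j * z j) \<le> b"
proof -
  have "(\<Sum>j\<in>UNIV. W k $ i $ j * z j) \<le> (\<Sum>j\<in>UNIV. W k $ i $ j * b)"
    by (intro sum_mono mult_left_mono assms W_nonneg)
  then show ?thesis
    by (simp add: sum_distrib_right[symmetric] W_row)
qed

lemma average_ge:
  assumes "\<And>j. a \<le> z j"
  shows "a \<le> (\<Sum>j\<in>UNIV. W k $ i $ j * z j)"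
  using average_le[of "\<lambda>j. - z j" "- a" k i] assms by (simp add: sum_negf)

text \<open>
  The set of indices whose value is at least \<open>\<delta> ^ m * c\<close> never loses elements, and gains
  one during every \<open>Suc Q\<close> steps until it is everything.
\<close>

lemma averaging_positive:
  fixes y :: "nat \<Rightarrow> 'p \<Rightarrow> real"
  assumes step: "\<And>m i. y (Suc m) i = (\<Sum>j\<in>UNIV. W (k + m) $ i $ j * y m j)"
    and nonneg: "\<And>i. y 0 i \<ge> 0" and j0: "y 0 j0 \<ge> c" and c: "c \<ge> 0"
  shows "y horizon i \<ge> \<delta> ^ horizon * c"
proof -
  define R where "R m = {i. y m i \<ge> \<delta> ^ m * c}" for m
  have y_nonneg: "y m i \<ge> 0" for m i
    by (induction m arbitrary: i) (auto simp: nonneg step intro!: sum_nonneg mult_nonneg_nonneg W_nonneg)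
  \<comment> \<open>Passing on a value through a weight of at least \<open>\<delta>\<close> costs
    one factor \<open>\<delta>\<close>, which the threshold at \<open>Suc m\<close> allows
    for.\<close>
  have spreads: "b \<in> R (Suc m)" if "a \<in> R m" "W (k + m) $ b $ a \<ge> \<delta>" for a b m
  proof -
    have "\<delta> * (\<delta> ^ m * c) \<le> W (k + m) $ b $ a * y m a"
      using that \<delta>_pos c by (intro mult_mono) (auto simp: R_def W_nonneg)
    also have "\<dots> \<le> y (Suc m) b"
      unfolding step
      by (rule member_le_sum[where f = "\<lambda>j. W (k + m) $ b $ j * y m j"]) (auto simp: W_nonneg y_nonneg)
    finally show ?thesis
      by (simp add: R_def mult_ac)
  qed
  have "R m \<subseteq> R (Suc m)" for m
    using spreads W_self by blast
  then have R_mono: "R m \<subseteq> R m'" if "m \<le> m'" for m m'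
    using that by (rule lift_Suc_mono_le)
  have "j0 \<in> R 0"
    by (simp add: R_def j0)
  with R_mono have j0_R: "j0 \<in> R m" for m
    by blast
  \<comment> \<open>A set unchanged over a whole block is constant inside it, hence closed under
    every edge of the window; connectivity from \<open>j0\<close> then makes it everything.\<close>
  have grow: "R m \<subset> R (m + Suc Q)" if "R m \<noteq> UNIV" for m
  proof (rule ccontr)
    assume "\<not> R m \<subset> R (m + Suc Q)"
    with R_mono[of m "m + Suc Q"] have eq: "R (m + Suc Q) = R m"
      by auto
    have const: "R (m + l) = R m" if "l \<le> Suc Q" for l
      using R_mono[of m "m + l"] R_mono[of "m + l" "m + Suc Q"] that eq by auto
    have "b \<in> R m" if "(j0, b) \<in> {(a, b). {a, b} \<in> (\<Union>l\<in>{1..Q}. E (l + (k + m)))}\<^sup>*" for b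
      using that
    proof induction
      case base
      show ?case by (rule j0_R)
    next
      case (step a b)
      then obtain l where l: "l \<in> {1..Q}" "{a, b} \<in> E (l + (k + m))"
        by auto
      then have "W (k + (m + l)) $ b $ a \<ge> \<delta>"
        by (intro W_ge) (auto simp: neighbours_def insert_commute add_ac)
      moreover have "a \<in> R (m + l)"
        using step.IH const l by simp
      ultimately have "b \<in> R (m + Suc l)"
        using spreads[of a "m + l" b] by simp
      then show ?case
        using const[of "Suc l"] l by simp
    qed
    then have "R m = UNIV"
      using connected[of "k + m"] unfolding graph_connected_def by auto
    with that show False ..
  qed
  \<comment> \<open>At \<open>n = CARD('p)\<close> the strict inequality is impossible, so the first
    alternative holds.\<close>
  have "R (n * Suc Q) = UNIV \<or> n < card (R (n * Suc Q))" for n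
  proof (induction n)
    case 0
    have "R 0 \<noteq> {}"
      using j0_R by blast
    then show ?case
      by (simp add: card_gt_0_iff)
  next
    case (Suc n)
    have eq: "Suc n * Suc Q = n * Suc Q + Suc Q"
      by simp
    show ?case
    proof (cases "R (n * Suc Q) = UNIV")
      case True
      then show ?thesis
        using R_mono[of "n * Suc Q" "Suc n * Suc Q"] by auto
    next
      case False
      then have "card (R (n * Suc Q)) < card (R (Suc n * Suc Q))"
        unfolding eq by (intro psubset_card_mono grow) auto
      then show ?thesis
        using Suc False by linarith
    qed
  qed
  from this[of "CARD('p)"] have "R horizon = UNIV"
    using card_mono[of UNIV "R horizon"] unfolding horizon_def by auto
  then show ?thesis
    by (auto simp: R_def)
qed

text \<open>Compare with the undisturbed averaging \<open>y\<close> started at time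
  \<open>k\<close>: it never exceeds the old maximum, and the excess of a maximiser over the minimum
  reaches every player with factor \<open>\<delta> ^ horizon\<close>. The disturbances shift either
  end by at most \<open>horizon * \<eta>\<close>.\<close>

lemma spread_contraction:
  fixes z d :: "nat \<Rightarrow> 'p \<Rightarrow> real"
  assumes step: "\<And>m i. z (Suc m) i = (\<Sum>j\<in>UNIV. W m $ i $ j * z m j) + d m i"
    and d: "\<And>m i. m \<ge> k \<Longrightarrow> \<bar>d m i\<bar> \<le> \<eta>"
  shows "spread (z (k + horizon)) \<le> (1 - \<delta> ^ horizon) * spread (z k) + 2 * real horizon * \<eta>"
proof -
  define y where "y = rec_nat (z k) (\<lambda>m u i. \<Sum>j\<in>UNIV. W (k + m) $ i $ j * u j)"
  have y_0: "y 0 = z k" and y_Suc: "y (Suc m) i = (\<Sum>j\<in>UNIV. W (k + m) $ i $ j * y m j)" for m i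
    by (simp_all add: y_def)
  \<comment> \<open>Averaging does not enlarge deviations, so each step adds at most
    \<open>\<eta>\<close>.\<close>
  have close: "\<bar>z (k + m) i - y m i\<bar> \<le> real m * \<eta>" for m i
  proof (induction m arbitrary: i)
    case 0
    show ?case by (simp add: y_0)
  next
    case (Suc m)
    have eq: "z (k + Suc m) i - y (Suc m) i
        = (\<Sum>j\<in>UNIV. W (k + m) $ i $ j * (z (k + m) j - y m j)) + d (k + m) i"
      by (simp add: step y_Suc algebra_simps sum_subtractf)
    have "(\<Sum>j\<in>UNIV. W (k + m) $ i $ j * (z (k + m) j - y m j)) \<le> real m * \<eta>"
      using Suc by (intro average_le) (auto simp: abs_le_iff)
    moreover have "- (real m * \<eta>) \<le> (\<Sum>j\<in>UNIV. W (k + m) $ i $ j * (z (k + m) j - y m j))"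
    proof (intro average_ge)
      show "- (real m * \<eta>) \<le> z (k + m) j - y m j" for j
        using Suc[of j] by linarith
    qed
    ultimately show ?case
      unfolding eq using d[of "k + m" i] by (auto simp: algebra_simps abs_le_iff)
  qed
  define lo hi where "lo = Min (range (z k))" and "hi = Max (range (z k))"
  have lo: "lo \<le> z k i" and hi: "z k i \<le> hi" for i
    by (simp_all add: lo_def hi_def)
  have "hi \<in> range (z k)"
    unfolding hi_def by (intro Max_in) auto
  then obtain j0 where j0: "hi = z k j0"
    by auto
  have upper: "y m i \<le> hi" for m i
    by (induction m arbitrary: i) (auto simp: y_0 y_Suc hi intro: average_le)
  \<comment> \<open>Rows sum to 1, so subtracting \<open>lo\<close> preserves the recursion; the
    shifted start is nonnegative and equals \<open>hi - lo\<close> at \<open>j0\<close>, as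
    \<open>averaging_positive\<close> requires.\<close>
  have "(\<lambda>i. y (Suc m) i - lo) i = (\<Sum>j\<in>UNIV. W (k + m) $ i $ j * (y m j - lo))" for m i
    by (simp add: y_Suc right_diff_distrib sum_subtractf sum_distrib_right[symmetric] W_row)
  then have "\<delta> ^ horizon * (hi - lo) \<le> y horizon i - lo" for i
    by (intro averaging_positive[where y = "\<lambda>m i. y m i - lo" and k = k and ?j0.0 = j0])
       (use lo[of j0] in \<open>auto simp: y_0 lo j0\<close>)
  then have lower: "lo + \<delta> ^ horizon * (hi - lo) \<le> y horizon i" for i
    by (simp add: algebra_simps)
  have "spread (z (k + horizon)) \<le> (hi + real horizon * \<eta>) - (lo + \<delta> ^ horizon * (hi - lo) - real horizon * \<eta>)"
  proof (rule spread_leI)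
    fix i
    show "z (k + horizon) i \<le> hi + real horizon * \<eta>"
      using close[of horizon i] upper[of horizon i] by linarith
    show "lo + \<delta> ^ horizon * (hi - lo) - real horizon * \<eta> \<le> z (k + horizon) i"
      using close[of horizon i] lower[of i] by linarith
  qed
  also have "\<dots> = (1 - \<delta> ^ horizon) * spread (z k) + 2 * real horizon * \<eta>"
    by (simp add: spread_def lo_def hi_def algebra_simps)
  finally show ?thesis .
qed

lemma horizon_pos: "horizon > 0"
  by (simp add: horizon_def)

lemma rate: "0 < \<delta> ^ horizon" "\<delta> ^ horizon \<le> 1"
  using \<delta>_pos \<delta>_le_1 by (auto intro: power_le_one)

text \<open>Strong induction in strides of \<open>horizon\<close>: the contraction preserves every
  upper bound \<open>B\<close> with \<open>b \<le> \<gamma> * B\<close>.\<close>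

lemma spread_bounded:
  fixes z d :: "nat \<Rightarrow> 'p \<Rightarrow> real"
  assumes step: "\<And>m i. z (Suc m) i = (\<Sum>j\<in>UNIV. W m $ i $ j * z m j) + d m i"
    and d: "\<And>m i. \<bar>d m i\<bar> \<le> \<eta>"
  obtains B where "\<And>k. spread (z k) \<le> B"
proof
  define \<gamma> where "\<gamma> = \<delta> ^ horizon"
  define b where "b = 2 * real horizon * \<eta>"
  \<comment> \<open>The maximum covers the first \<open>horizon\<close> values, which have no
    predecessor one stride back; the added term gives \<open>b \<le> \<gamma> * B\<close>.\<close>
  define B where "B = Max ((\<lambda>k. spread (z k)) ` {..<horizon}) + \<bar>b\<bar> / \<gamma>"
  have \<gamma>: "0 < \<gamma>" "\<gamma> \<le> 1"
    using rate by (simp_all add: \<gamma>_def)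
  have init: "spread (z k) + \<bar>b\<bar> / \<gamma> \<le> B" if "k < horizon" for k
    unfolding B_def using that by (intro add_right_mono Max_ge) auto
  have "b \<le> \<gamma> * B"
  proof -
    have "\<bar>b\<bar> / \<gamma> \<le> B"
      using init[OF horizon_pos] spread_nonneg[of "z 0"] by linarith
    then show ?thesis
      using \<gamma> by (simp add: field_simps)
  qed
  show "spread (z k) \<le> B" for k
  proof (induction k rule: less_induct)
    case (less k)
    show ?case
    proof (cases "k < horizon")
      case True
      moreover have "0 \<le> \<bar>b\<bar> / \<gamma>"
        using \<gamma> by simp
      ultimately show ?thesis
        using init[of k] by linarith
    next
      case False
      then have "spread (z k) \<le> (1 - \<gamma>) * spread (z (k - horizon)) + b"
        using spread_contraction[OF step d, of "k - horizon"] by (simp add: \<gamma>_def b_def)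
      also have "(1 - \<gamma>) * spread (z (k - horizon)) \<le> (1 - \<gamma>) * B"
        using False horizon_pos \<gamma> by (intro mult_left_mono less) auto
      finally show ?thesis
        using \<open>b \<le> \<gamma> * B\<close> by (simp add: algebra_simps)
    qed
  qed
qed

text \<open>The spread is bounded by some \<open>B\<close>. Once the disturbances are small, each
  stride of \<open>horizon\<close> multiplies the excess over a given \<open>\<epsilon>\<close> by
  \<open>1 - \<gamma>\<close>, so \<open>n\<close> strides leave
  \<open>(1 - \<gamma>) ^ n * B + \<epsilon>\<close>.\<close>

lemma spread_tendsto_0:
  fixes z d :: "nat \<Rightarrow> 'p \<Rightarrow> real"
  assumes step: "\<And>m i. z (Suc m) i = (\<Sum>j\<in>UNIV. W m $ i $ j * z m j) + d m i"
    and d: "\<And>i. (\<lambda>m. d m i) \<longlonglongrightarrow> 0"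
  shows "(\<lambda>k. spread (z k)) \<longlonglongrightarrow> 0"
proof -
  define \<gamma> where "\<gamma> = \<delta> ^ horizon"
  have \<gamma>: "0 < \<gamma>" "\<gamma> \<le> 1"
    using rate by (simp_all add: \<gamma>_def)
  have d_0: "(\<lambda>m. \<Sum>i\<in>UNIV. \<bar>d m i\<bar>) \<longlonglongrightarrow> 0"
    by (intro tendsto_null_sum tendsto_rabs_zero d)
  then have "Bseq (\<lambda>m. \<Sum>i\<in>UNIV. \<bar>d m i\<bar>)"
    by (intro convergent_imp_Bseq convergentI)
  then obtain \<eta>0 where "norm (\<Sum>i\<in>UNIV. \<bar>d m i\<bar>) \<le> \<eta>0" for m
    unfolding Bseq_def by blast
  moreover have d_le: "\<bar>d m i\<bar> \<le> (\<Sum>i\<in>UNIV. \<bar>d m i\<bar>)" for m i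
    by (rule member_le_sum) auto
  ultimately have "\<bar>d m i\<bar> \<le> \<eta>0" for m i
    by (metis abs_ge_self order_trans real_norm_def)
  then obtain B where B: "spread (z k) \<le> B" for k
    using spread_bounded[OF step] by blast
  have eventually_le: "\<forall>\<^sub>F k in sequentially. spread (z k) \<le> (1 - \<gamma>) ^ n * B + \<epsilon>"
    if "\<epsilon> > 0" for n \<epsilon>
  proof (induction n)
    case 0
    have "spread (z k) \<le> B + \<epsilon>" for k
      using B[of k] that by linarith
    then show ?case
      by simp
  next
    case (Suc n)
    \<comment> \<open>Chosen so that the disturbance term is \<open>\<gamma> * \<epsilon>\<close>,
      exactly what \<open>(1 - \<gamma>) * \<epsilon>\<close> lacks to
      \<open>\<epsilon>\<close>.\<close>
    define \<eta> where "\<eta> = \<gamma> * \<epsilon> / (2 * real horizon)"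
    have "\<eta> > 0"
      using \<gamma> that horizon_pos by (simp add: \<eta>_def)
    with d_0 have "\<forall>\<^sub>F m in sequentially. (\<Sum>i\<in>UNIV. \<bar>d m i\<bar>) < \<eta>"
      by (rule order_tendstoD)
    then obtain M where "m \<ge> M \<Longrightarrow> (\<Sum>i\<in>UNIV. \<bar>d m i\<bar>) < \<eta>" for m
      unfolding eventually_sequentially by blast
    then have small: "\<bar>d m i\<bar> \<le> \<eta>" if "m \<ge> M" for m i
      using d_le[of m i] that by fastforce
    have "\<forall>\<^sub>F k in sequentially. spread (z (k + horizon)) \<le> (1 - \<gamma>) ^ Suc n * B + \<epsilon>"
      using Suc eventually_ge_at_top[of M]
    proof eventually_elim
      case (elim k)
      have "spread (z (k + horizon)) \<le> (1 - \<gamma>) * spread (z k) + 2 * real horizon * \<eta>"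
        unfolding \<gamma>_def using elim by (intro spread_contraction[OF step] small) auto
      also have "2 * real horizon * \<eta> = \<gamma> * \<epsilon>"
        using horizon_pos by (simp add: \<eta>_def)
      also have "(1 - \<gamma>) * spread (z k) \<le> (1 - \<gamma>) * ((1 - \<gamma>) ^ n * B + \<epsilon>)"
        using elim \<gamma> by (intro mult_left_mono) auto
      finally show ?case
        by (simp add: algebra_simps)
    qed
    then show ?case
      by (rule eventually_sequentially_seg[THEN iffD1])
  qed
  show ?thesis
  proof (rule order_tendstoI)
    show "\<forall>\<^sub>F k in sequentially. a < spread (z k)" if "a < 0" for a
      by (intro always_eventually allI less_le_trans[OF that] spread_nonneg)
  next
    fix a :: real
    assume a: "0 < a"
    have "(\<lambda>n. (1 - \<gamma>) ^ n * B) \<longlonglongrightarrow> 0"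
      using \<gamma> by (intro tendsto_mult_left_zero LIMSEQ_power_zero) auto
    then have "\<forall>\<^sub>F n in sequentially. (1 - \<gamma>) ^ n * B < a / 2"
      using a by (intro order_tendstoD) auto
    then obtain n where n: "(1 - \<gamma>) ^ n * B < a / 2"
      by (auto simp: eventually_sequentially)
    have "\<forall>\<^sub>F k in sequentially. spread (z k) \<le> (1 - \<gamma>) ^ n * B + a / 2"
      using a by (intro eventually_le) simp
    then show "\<forall>\<^sub>F k in sequentially. spread (z k) < a"
    proof eventually_elim
      case (elim k)
      with n show ?case by linarith
    qed
  qed
qed

end


section \<open>Descent with vanishing errors\<close>

text \<open>Here \<open>r\<close> will be the squared distance to the solution,
  \<open>\<psi>\<close> the monotonicity gap and \<open>\<beta>\<close> the error. As
  \<open>\<alpha> k * \<beta> k\<close> may fail to be summable, the argument is one of trapping: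
  \<open>r\<close> falls below \<open>\<epsilon>\<close> and can then no longer pass
  \<open>2 * \<epsilon>\<close>.\<close>

lemma perturbed_descent_tendsto_0:
  fixes r \<alpha> \<psi> \<beta> :: "nat \<Rightarrow> real"
  assumes step: "\<And>k. r (Suc k) \<le> r k - \<alpha> k * \<psi> k + \<alpha> k * \<beta> k"
    and r: "\<And>k. r k \<ge> 0" and \<psi>: "\<And>k. \<psi> k \<ge> 0"
    and gap: "\<And>\<epsilon>. \<epsilon> > 0 \<Longrightarrow> \<exists>c>0. \<forall>k. r k \<ge> \<epsilon> \<longrightarrow> \<psi> k \<ge> c"
    and \<alpha>: "\<And>k. \<alpha> k > 0" "\<alpha> \<longlonglongrightarrow> 0" "filterlim (\<lambda>m. \<Sum>k<m. \<alpha> k) at_top sequentially"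
    and \<beta>: "\<beta> \<longlonglongrightarrow> 0"
  shows "r \<longlonglongrightarrow> 0"
proof (rule order_tendstoI)
  show "\<forall>\<^sub>F k in sequentially. a < r k" if "a < 0" for a
    using less_le_trans[OF that r] by simp
next
  fix a :: real
  assume "0 < a"
  define \<epsilon> where "\<epsilon> = a / 3"
  have \<epsilon>: "\<epsilon> > 0"
    using \<open>0 < a\<close> by (simp add: \<epsilon>_def)
  obtain c where c: "c > 0" "r k \<ge> \<epsilon> \<Longrightarrow> \<psi> k \<ge> c" for k
    using gap[OF \<epsilon>] by blast
  have "(\<lambda>k. \<alpha> k * \<beta> k) \<longlonglongrightarrow> 0"
    using tendsto_mult[OF \<alpha>(2) \<beta>] by simp
  then have "\<forall>\<^sub>F k in sequentially. \<alpha> k * \<beta> k < \<epsilon>"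
    using \<epsilon> by (rule order_tendstoD)
  moreover have "\<forall>\<^sub>F k in sequentially. \<beta> k < c / 2"
    using \<beta> c by (intro order_tendstoD) auto
  ultimately have "\<forall>\<^sub>F k in sequentially. \<alpha> k * \<beta> k < \<epsilon> \<and> \<beta> k < c / 2"
    by eventually_elim auto
  then obtain M where M: "k \<ge> M \<Longrightarrow> \<alpha> k * \<beta> k < \<epsilon> \<and> \<beta> k < c / 2" for k
    by (auto simp: eventually_sequentially)
  have far: "r (Suc k) \<le> r k - c / 2 * \<alpha> k" if "k \<ge> M" "r k \<ge> \<epsilon>" for k
  proof -
    have "\<alpha> k * (c / 2) \<le> \<alpha> k * (\<psi> k - \<beta> k)"
      using M[OF that(1)] c(2)[OF that(2)] \<alpha>(1)[of k] by (intro mult_left_mono) auto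
    then show ?thesis
      using step[of k] by (simp add: algebra_simps)
  qed
  have near: "r (Suc k) \<le> 2 * \<epsilon>" if "k \<ge> M" "r k < \<epsilon>" for k
    using step[of k] M[OF that(1)] that(2) mult_nonneg_nonneg[of "\<alpha> k" "\<psi> k"] \<alpha>(1)[of k] \<psi>[of k]
    by linarith
  \<comment> \<open>Otherwise \<open>r\<close> plus \<open>c / 2\<close> times the partial sums of
    \<open>\<alpha>\<close> never increases after \<open>M\<close>, which bounds a divergent
    sum.\<close>
  obtain k1 where k1: "k1 \<ge> M" "r k1 < \<epsilon>"
  proof (rule ccontr)
    assume "\<not> thesis"
    with that have always_far: "r k \<ge> \<epsilon>" if "k \<ge> M" for k
      using that by force
    have "r (M + n) + c / 2 * (\<Sum>k<M + n. \<alpha> k) \<le> r M + c / 2 * (\<Sum>k<M. \<alpha> k)" for n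
    proof (induction n)
      case (Suc n)
      then show ?case
        using far[of "M + n"] always_far[of "M + n"] by (simp add: algebra_simps)
    qed simp
    then have "c / 2 * (\<Sum>k<M + n. \<alpha> k) \<le> r M + c / 2 * (\<Sum>k<M. \<alpha> k)" for n
      by (smt (verit) r)
    then have bd: "(\<Sum>k<M + n. \<alpha> k) \<le> (r M + c / 2 * (\<Sum>k<M. \<alpha> k)) / (c / 2)" for n
      using c(1) by (simp add: pos_le_divide_eq mult.commute)
    have "\<forall>\<^sub>F m in sequentially. (\<Sum>k<m. \<alpha> k) > (r M + c / 2 * (\<Sum>k<M. \<alpha> k)) / (c / 2)"
      using \<alpha>(3) by (simp add: filterlim_at_top_dense)
    then obtain m where "\<And>n. n \<ge> m \<Longrightarrow> (\<Sum>k<n. \<alpha> k) > (r M + c / 2 * (\<Sum>k<M. \<alpha> k)) / (c / 2)"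
      by (auto simp: eventually_sequentially)
    from this[of "M + m"] bd[of m] show False
      by simp
  qed
  \<comment> \<open>From below \<open>\<epsilon>\<close> a single step reaches at most
    \<open>2 * \<epsilon>\<close>; from \<open>\<epsilon>\<close> upwards a step does not increase
    \<open>r\<close>.\<close>
  have "r k \<le> 2 * \<epsilon>" if "k \<ge> k1" for k
    using that
  proof (induction k rule: dec_induct)
    case base
    then show ?case using k1 \<epsilon> by simp
  next
    case (step k)
    show ?case
    proof (cases "r k < \<epsilon>")
      case True
      then show ?thesis using near k1 step by simp
    next
      case False
      moreover have "c / 2 * \<alpha> k \<ge> 0"
        using c(1) \<alpha>(1)[of k] by simp
      ultimately show ?thesis
        using far[of k] k1 step by simp
    qed
  qed
  moreover have "2 * \<epsilon> < a"
    using \<open>0 < a\<close> by (simp add: \<epsilon>_def)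
  ultimately show "\<forall>\<^sub>F k in sequentially. r k < a"
    unfolding eventually_sequentially by (meson le_less_trans)
qed


section \<open>Variational inequalities with strictly monotone maps\<close>

text \<open>A fixed point of the projected step, given by Brouwer's theorem, solves the inequality
  by the obtuse-angle property of projections.\<close>

lemma solves_VI_exists:
  fixes \<phi> :: "'a::euclidean_space \<Rightarrow> 'a"
  assumes S: "compact S" "convex S" "S \<noteq> {}" and cont: "continuous_on S \<phi>"
  shows "\<exists>a. solves_VI S \<phi> a"
proof -
  have "continuous_on S (\<lambda>x. closest_point S (x - \<phi> x))"
    using S by (intro continuous_on_compose2[OF continuous_on_closest_point[of S UNIV]] continuous_intros cont)
      (auto simp: compact_imp_closed)
  moreover have "(\<lambda>x. closest_point S (x - \<phi> x)) \<in> S \<rightarrow> S"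
    using S by (auto simp: compact_imp_closed closest_point_in_set)
  ultimately obtain a where a: "a \<in> S" "closest_point S (a - \<phi> a) = a"
    using brouwer[OF S] by blast
  have "(x - a) \<bullet> \<phi> a \<ge> 0" if "x \<in> S" for x
    using closest_point_dot[of S x "a - \<phi> a"] S a that
    by (simp add: compact_imp_closed inner_commute)
  with a show ?thesis
    unfolding solves_VI_def by blast
qed

text \<open>Each inequality is tested at the other solution; their sum contradicts strict
  monotonicity.\<close>

lemma solves_VI_unique:
  assumes "strictly_monotone_over S \<phi>" "solves_VI S \<phi> a" "solves_VI S \<phi> b"
  shows "a = b"
proof (rule ccontr)
  assume "a \<noteq> b"
  then have "(\<phi> a - \<phi> b) \<bullet> (a - b) > 0"
    using assms unfolding strictly_monotone_over_def solves_VI_def by blast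
  moreover have "(b - a) \<bullet> \<phi> a \<ge> 0" "(a - b) \<bullet> \<phi> b \<ge> 0"
    using assms unfolding solves_VI_def by blast+
  ultimately show False
    by (simp add: inner_diff_left inner_diff_right inner_commute)
qed

text \<open>Compactness turns pointwise positivity into a uniform bound away from
  \<open>a\<close>.\<close>

lemma strictly_monotone_gap:
  assumes S: "compact S" and cont: "continuous_on S \<phi>"
    and mono: "strictly_monotone_over S \<phi>" and a: "a \<in> S" and \<epsilon>: "\<epsilon> > (0::real)"
  obtains c where "c > 0" "\<And>x. x \<in> S \<Longrightarrow> \<epsilon> \<le> (norm (x - a))\<^sup>2 \<Longrightarrow> c \<le> (\<phi> x - \<phi> a) \<bullet> (x - a)"
proof -
  define T where "T = S \<inter> {x. \<epsilon> \<le> (norm (x - a))\<^sup>2}"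
  have pos: "(\<phi> x - \<phi> a) \<bullet> (x - a) > 0" if "x \<in> T" for x
    using that \<epsilon> a mono unfolding T_def strictly_monotone_over_def by force
  have "compact T"
    unfolding T_def by (intro compact_Int_closed S closed_Collect_le continuous_intros)
  moreover have "continuous_on T (\<lambda>x. (\<phi> x - \<phi> a) \<bullet> (x - a))"
    by (intro continuous_intros continuous_on_subset[OF cont]) (auto simp: T_def)
  moreover have "\<not> (\<exists>x\<in>T. (\<phi> x - \<phi> a) \<bullet> (x - a) = 0)"
    using pos by fastforce
  \<comment> \<open>This form of the extreme value theorem also covers an empty
    \<open>T\<close>.\<close>
  ultimately obtain c where c: "c > 0" "\<forall>x\<in>T. c \<le> norm ((\<phi> x - \<phi> a) \<bullet> (x - a))"
    by (rule brouwer_compactness_lemma)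
  have "c \<le> (\<phi> x - \<phi> a) \<bullet> (x - a)" if "x \<in> S" "\<epsilon> \<le> (norm (x - a))\<^sup>2" for x
  proof -
    have "x \<in> T"
      using that by (simp add: T_def)
    with c(2) pos[of x] show ?thesis
      by fastforce
  qed
  with c(1) show thesis
    by (rule that)
qed

text \<open>Projection is nonexpansive and fixes \<open>a\<close>. With \<open>a\<close> the current
  iterate this bounds the step; with \<open>a\<close> the solution it gives the descent.\<close>

lemma closest_point_step:
  assumes "convex S" "closed S" "a \<in> S"
  shows "norm (closest_point S y - a) \<le> norm (y - a)"
  using closest_point_lipschitz[of S y a] closest_point_self[of a S] assms
  by (auto simp: dist_norm)


section \<open>Strategy profiles and gradients\<close>

lemma norm_le_sum_norm_nth: "norm x \<le> (\<Sum>i\<in>UNIV. norm (x $ i))"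
  unfolding norm_vec_def by (rule L2_set_le_sum) simp

lemma compact_profiles:
  assumes "\<And>i. compact (K i)"
  shows "compact (profiles K)"
proof -
  have "closed (profiles K)"
    unfolding profiles_def Collect_all_eq
    by (intro closed_INT ballI closed_vimage_vec_nth[unfolded vimage_def] compact_imp_closed assms)
  moreover have "\<exists>B. \<forall>y\<in>K i. norm y \<le> B" for i
    using compact_imp_bounded[OF assms] by (simp add: bounded_iff)
  then obtain B where B: "\<And>i y. y \<in> K i \<Longrightarrow> norm y \<le> B i"
    by metis
  have "norm x \<le> (\<Sum>i\<in>UNIV. B i)" if "x \<in> profiles K" for x
  proof -
    have "norm x \<le> (\<Sum>i\<in>UNIV. norm (x $ i))"
      by (rule norm_le_sum_norm_nth)
    also have "\<dots> \<le> (\<Sum>i\<in>UNIV. B i)"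
      using that by (intro sum_mono B) (auto simp: profiles_def)
    finally show ?thesis .
  qed
  then have "bounded (profiles K)"
    unfolding bounded_iff by blast
  ultimately show ?thesis
    by (simp add: compact_eq_bounded_closed)
qed

lemma convex_profiles:
  assumes "\<And>i. convex (K i)"
  shows "convex (profiles K)"
  using assms by (simp add: profiles_def convex_def)

lemma profiles_nonempty:
  assumes "\<And>i. K i \<noteq> {}"
  shows "profiles K \<noteq> {}"
proof -
  have "(\<chi> i. SOME y. y \<in> K i) \<in> profiles K"
    using assms by (simp add: profiles_def some_in_eq)
  then show ?thesis
    by blast
qed

lemma sum_in_aggregates:
  assumes "x \<in> profiles K"
  shows "(\<Sum>i\<in>UNIV. x $ i) \<in> aggregates K"
  using assms unfolding aggregates_def set_sum_alt[OF finite] profiles_def by auto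

text \<open>By the chain rule along \<open>z \<mapsto> (z, u)\<close> and
  \<open>w \<mapsto> (y, w)\<close>, the partial gradients are the components of the continuous
  joint gradient.\<close>

lemma continuous_on_grad_map:
  assumes "continuously_differentiable_on (\<lambda>(y, u). g y u) D"
  shows "continuous_on D (\<lambda>(y, u). grad_map g y u)"
proof -
  obtain g' where cont: "continuous_on D g'"
    and deriv: "\<And>a. a \<in> D \<Longrightarrow> GDERIV (\<lambda>(y, u). g y u) a :> g' a"
    using assms unfolding continuously_differentiable_on_def by blast
  have "grad_map g y u = fst (g' (y, u)) + snd (g' (y, u))" if "(y, u) \<in> D" for y u
  proof -
    have has_deriv: "((\<lambda>(y, u). g y u) has_derivative (\<lambda>h. h \<bullet> g' (y, u))) (at (y, u))"
      using deriv[OF that] by (simp add: gderiv_def)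
    have "((\<lambda>z. (z, u)) has_derivative (\<lambda>h. (h, 0))) (at y)"
      by (auto intro!: derivative_eq_intros)
    from has_derivative_compose[OF this has_deriv]
    have 1: "grad (\<lambda>z. g z u) y = fst (g' (y, u))"
      by (intro grad_eqI) (simp add: gderiv_def inner_prod_def)
    have "((\<lambda>w. (y, w)) has_derivative (\<lambda>h. (0, h))) (at u)"
      by (auto intro!: derivative_eq_intros)
    from has_derivative_compose[OF this has_deriv]
    have 2: "grad (\<lambda>w. g y w) u = snd (g' (y, u))"
      by (intro grad_eqI) (simp add: gderiv_def inner_prod_def)
    show ?thesis
      by (simp add: grad_map_def 1 2)
  qed
  moreover have "continuous_on D (\<lambda>p. fst (g' p) + snd (g' p))"
    by (intro continuous_intros cont)
  ultimately show ?thesis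
    by (subst continuous_on_cong[OF refl, of _ _ "\<lambda>p. fst (g' p) + snd (g' p)"]) auto
qed


section \<open>Tracking the aggregate\<close>

locale tracking = averaging E W \<delta> Q
  for E :: "nat \<Rightarrow> 'p::finite set set" and W :: "nat \<Rightarrow> real ^ 'p ^ 'p" and \<delta> Q +
  fixes x v :: "nat \<Rightarrow> (real ^ 'n) ^ 'p"
  assumes W_column: "\<And>k j. (\<Sum>i\<in>UNIV. W k $ i $ j) = 1"
    and v_0: "\<And>i. v 0 $ i = x 0 $ i"
    and v_Suc: "\<And>k i. v (Suc k) $ i = mixed_estimate (W k) (v k) i + x (Suc k) $ i - x k $ i"
begin

lemma sum_mixed_estimate: "(\<Sum>i\<in>UNIV. mixed_estimate (W k) w i) = (\<Sum>j\<in>UNIV. w $ j)"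
proof -
  have "(\<Sum>i\<in>UNIV. mixed_estimate (W k) w i) = (\<Sum>j\<in>UNIV. \<Sum>i\<in>UNIV. W k $ i $ j *\<^sub>R w $ j)"
    unfolding mixed_estimate_def by (rule sum.swap)
  then show ?thesis
    by (simp add: scaleR_left.sum[symmetric] W_column)
qed

text \<open>Column sums of 1 make mixing preserve the total, and the update adds exactly the
  increments of \<open>x\<close>.\<close>

lemma sum_v: "(\<Sum>i\<in>UNIV. v k $ i) = (\<Sum>i\<in>UNIV. x k $ i)"
  by (induction k) (simp_all add: v_0 v_Suc sum.distrib sum_subtractf sum_mixed_estimate)

definition tracking_error :: "nat \<Rightarrow> 'p \<Rightarrow> real ^ 'n" where
  "tracking_error k i = real CARD('p) *\<^sub>R mixed_estimate (W k) (v k) i - (\<Sum>j\<in>UNIV. x k $ j)"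

text \<open>By \<open>sum_v\<close>, each coordinate of the error is the sum over \<open>j\<close>
  of the differences between an average of the estimates and the estimate of \<open>j\<close>, each
  at most the spread.\<close>

lemma norm_tracking_error_le:
  "norm (tracking_error k i) \<le> (\<Sum>c\<in>UNIV. real CARD('p) * spread (\<lambda>j. v k $ j $ c))"
proof -
  have "\<bar>tracking_error k i $ c\<bar> \<le> real CARD('p) * spread (\<lambda>j. v k $ j $ c)" for c
  proof -
    let ?z = "\<lambda>j. v k $ j $ c"
    define m where "m = (\<Sum>l\<in>UNIV. W k $ i $ l * ?z l)"
    have "\<bar>m - ?z j\<bar> \<le> spread ?z" for j
    proof -
      have eq: "m - ?z j = (\<Sum>l\<in>UNIV. W k $ i $ l * (?z l - ?z j))"
        by (simp add: m_def right_diff_distrib sum_subtractf sum_distrib_right[symmetric] W_row)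
      have "m - ?z j \<le> spread ?z"
        unfolding eq by (intro average_le spread_diff_le)
      moreover have "- spread ?z \<le> m - ?z j"
        unfolding eq
      proof (intro average_ge)
        show "- spread ?z \<le> ?z l - ?z j" for l
          using spread_diff_le[of ?z j l] by linarith
      qed
      ultimately show ?thesis
        by linarith
    qed
    then have "(\<Sum>j\<in>UNIV. \<bar>m - ?z j\<bar>) \<le> (\<Sum>j\<in>(UNIV :: 'p set). spread ?z)"
      by (rule sum_mono)
    moreover have "tracking_error k i $ c = (\<Sum>j\<in>UNIV. m - ?z j)"
      by (simp add: tracking_error_def sum_v[symmetric] m_def mixed_estimate_def sum_subtractf)
    ultimately show ?thesis
      using order_trans[OF sum_abs[of "\<lambda>j. m - ?z j" UNIV]] by simp
  qed
  then show ?thesis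
    using norm_le_l1_cart[of "tracking_error k i"] by (meson order_trans sum_mono)
qed

lemma component_step:
  "v (Suc k) $ i $ c = (\<Sum>j\<in>UNIV. W k $ i $ j * v k $ j $ c) + (x (Suc k) $ i - x k $ i) $ c"
  by (simp add: v_Suc mixed_estimate_def)

text \<open>Breaks a circle: bounding the gradients requires bounded evaluation points, and these
  follow already from bounded increments of \<open>x\<close>, before any gradient bound is
  known.\<close>

lemma tracking_error_bounded:
  assumes "\<And>k i. norm (x (Suc k) $ i - x k $ i) \<le> \<eta>"
  obtains B where "\<And>k i. norm (tracking_error k i) \<le> B"
proof -
  have "\<bar>(x (Suc k) $ i - x k $ i) $ c\<bar> \<le> \<eta>" for k i c
    using component_le_norm_cart assms by (rule order_trans)
  then have "\<exists>B. \<forall>k. spread (\<lambda>j. v k $ j $ c) \<le> B" for c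
    using spread_bounded[where z = "\<lambda>k j. v k $ j $ c", OF component_step] by metis
  then obtain B where "\<And>c k. spread (\<lambda>j. v k $ j $ c) \<le> B c"
    by metis
  then have "norm (tracking_error k i) \<le> (\<Sum>c\<in>UNIV. real CARD('p) * B c)" for k i
    by (intro order_trans[OF norm_tracking_error_le] sum_mono mult_left_mono) auto
  then show thesis
    by (rule that)
qed

lemma tracking_error_tendsto_0:
  assumes "\<And>i. (\<lambda>k. x (Suc k) $ i - x k $ i) \<longlonglongrightarrow> 0"
  shows "(\<lambda>k. tracking_error k i) \<longlonglongrightarrow> 0"
proof -
  have "(\<lambda>k. (x (Suc k) $ i - x k $ i) $ c) \<longlonglongrightarrow> 0" for i c
    using tendsto_vec_nth[OF assms] by simp
  then have "(\<lambda>k. spread (\<lambda>j. v k $ j $ c)) \<longlonglongrightarrow> 0" for c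
    using spread_tendsto_0[where z = "\<lambda>k j. v k $ j $ c", OF component_step] by metis
  then have "(\<lambda>k. \<Sum>c\<in>UNIV. real CARD('p) * spread (\<lambda>j. v k $ j $ c)) \<longlonglongrightarrow> 0"
    by (intro tendsto_null_sum tendsto_mult_right_zero)
  then show ?thesis
    by (rule Lim_null_comparison[rotated]) (simp add: norm_tracking_error_le)
qed

end


section \<open>Convergence of the algorithm\<close>

theorem proposition2:
  fixes K :: "'p::finite \<Rightarrow> (real ^ 'n) set"
    and f :: "'p \<Rightarrow> real ^ 'n \<Rightarrow> real ^ 'n \<Rightarrow> real"
    and D :: "'p \<Rightarrow> ((real ^ 'n) \<times> (real ^ 'n)) set"
    and E :: "nat \<Rightarrow> 'p set set"
    and W :: "nat \<Rightarrow> real ^ 'p ^ 'p"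
    and \<alpha> :: "nat \<Rightarrow> real"
    and \<delta> :: real and Q :: nat
    and x v :: "nat \<Rightarrow> (real ^ 'n) ^ 'p"
  assumes K: "\<And>i. K i \<noteq> {}" "\<And>i. compact (K i)" "\<And>i. convex (K i)"
    and smooth: "\<And>i. open (D i)" "\<And>i. K i \<times> aggregates K \<subseteq> D i"
      "\<And>i. continuously_differentiable_on (\<lambda>(y, u). f i y u) (D i)"
    and cvx: "\<And>i y. y \<in> profiles K \<Longrightarrow>
      convex_on (K i) (\<lambda>z. f i z (z + (\<Sum>j\<in>UNIV - {i}. y $ j)))"
    and mono: "strictly_monotone_over (profiles K) (game_map f)"
    and lipschitz: "\<And>i. \<exists>L>0. \<forall>y\<in>K i. \<forall>z1\<in>aggregates K. \<forall>z2\<in>aggregates K.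
      norm (grad_map (f i) y z1 - grad_map (f i) y z2) \<le> L * norm (z1 - z2)"
    and graph: "\<And>k. undirected_edges (E k)"
      "Q \<ge> 1" "\<And>k. graph_connected (\<Union>l\<in>{1..Q}. E (l + k))"
    and weights: "\<delta> > 0"
      "\<And>k i j. W k $ i $ j \<ge> 0"
      "\<And>k i j. j \<in> neighbours (E k) i \<Longrightarrow> W k $ i $ j \<ge> \<delta>"
      "\<And>k i j. j \<notin> neighbours (E k) i \<Longrightarrow> W k $ i $ j = 0"
      "\<And>k i. (\<Sum>j\<in>UNIV. W k $ i $ j) = 1"
      "\<And>k j. (\<Sum>i\<in>UNIV. W k $ i $ j) = 1"
    and steps: "\<And>k. \<alpha> k > 0" "\<And>k. \<alpha> (Suc k) \<le> \<alpha> k"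
      "filterlim (\<lambda>m. \<Sum>k<m. \<alpha> k) at_top sequentially"
      "summable (\<lambda>k. (\<alpha> k)\<^sup>2)"
    and algorithm: "synchronous_algorithm K f W \<alpha> x v"
    and well_posed: "well_posed_run D W x v"
  shows "\<exists>xs. solves_VI (profiles K) (game_map f) xs \<and>
    (\<forall>y. solves_VI (profiles K) (game_map f) y \<longrightarrow> y = xs) \<and>
    x \<longlonglongrightarrow> xs"
proof -
  define S where "S = profiles K"
  define \<phi> where "\<phi> = game_map f"
  define F where "F i = (\<lambda>(y, u). grad_map (f i) y u)" for i
  define agg where "agg = (\<lambda>y :: (real ^ 'n) ^ 'p. \<Sum>j\<in>UNIV. y $ j)"
  define u where "u k i = real CARD('p) *\<^sub>R mixed_estimate (W k) (v k) i" for k i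
  define G where "G k = (\<chi> i. F i (x k $ i, u k i))" for k

  \<comment> \<open>Feasibility of the iterates\<close>
  have closed_K: "closed (K i)" for i
    by (intro compact_imp_closed K)
  have S: "compact S" "convex S" "S \<noteq> {}"
    using K by (simp_all add: S_def compact_profiles convex_profiles profiles_nonempty)
  have x_Suc: "x (Suc k) $ i = closest_point (K i) (x k $ i - \<alpha> k *\<^sub>R G k $ i)" for k i
    using algorithm by (simp add: synchronous_algorithm_def G_def F_def u_def)
  have x_in_K: "x k $ i \<in> K i" for k i
  proof (cases k)
    case 0
    then show ?thesis
      using algorithm by (simp add: synchronous_algorithm_def)
  next
    case (Suc m)
    then show ?thesis
      by (simp add: x_Suc closest_point_in_set closed_K K)
  qed
  then have x_in_S: "x k \<in> S" for k
    by (simp add: S_def profiles_def)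

  interpret tracking E W \<delta> Q x v
    using graph weights algorithm by unfold_locales (auto simp: synchronous_algorithm_def)
  have u_eq: "u k i = agg (x k) + tracking_error k i" for k i
    by (simp add: u_def tracking_error_def agg_def)

  \<comment> \<open>Continuity of the game map and existence of a solution\<close>
  have cont_F: "continuous_on (D i) (F i)" for i
    unfolding F_def by (intro continuous_on_grad_map smooth)
  have cont_pair: "continuous_on S (\<lambda>y. (y $ i, agg y))" for i
    unfolding agg_def by (intro continuous_intros)
  have pair_in_D: "(y $ i, agg y) \<in> D i" if "y \<in> S" for y i
  proof -
    have "(y $ i, agg y) \<in> K i \<times> aggregates K"
      using that sum_in_aggregates[of y K] by (auto simp: S_def agg_def profiles_def)
    then show ?thesis
      using smooth(2) by blast
  qed
  have \<phi>_nth: "\<phi> y $ i = F i (y $ i, agg y)" for y i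
    by (simp add: \<phi>_def game_map_def F_def agg_def)
  have cont_\<phi>: "continuous_on S \<phi>"
  proof -
    have "continuous_on S (\<lambda>y. F i (y $ i, agg y))" for i
      using pair_in_D by (intro continuous_on_compose2[OF cont_F cont_pair]) auto
    then have "continuous_on S (\<lambda>y. \<chi> i. F i (y $ i, agg y))"
      by (rule continuous_on_vec_lambda)
    moreover have "\<phi> = (\<lambda>y. \<chi> i. F i (y $ i, agg y))"
      by (simp add: fun_eq_iff vec_eq_iff \<phi>_nth)
    ultimately show ?thesis
      by simp
  qed
  obtain xs where xs: "solves_VI S \<phi> xs"
    using solves_VI_exists[OF S cont_\<phi>] by blast
  then have xs_in_S: "xs \<in> S"
    by (simp add: solves_VI_def)
  have mono': "strictly_monotone_over S \<phi>"
    using mono by (simp add: S_def \<phi>_def)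

  \<comment> \<open>Compact sets of evaluation points\<close>
  obtain B where B: "\<And>y. y \<in> S \<Longrightarrow> norm y \<le> B"
    using compact_imp_bounded[OF S(1)] by (auto simp: bounded_iff)
  have diff_le: "norm (y - z) \<le> 2 * B" if "y \<in> S" "z \<in> S" for y z
    using norm_triangle_ineq4[of y z] B[OF that(1)] B[OF that(2)] by linarith
  have "norm (x (Suc k) $ i - x k $ i) \<le> 2 * B" for k i
    using Finite_Cartesian_Product.norm_nth_le[of "x (Suc k) - x k" i] diff_le[OF x_in_S x_in_S, of "Suc k" k]
    by simp
  then obtain B' where B': "\<And>k i. norm (tracking_error k i) \<le> B'"
    using tracking_error_bounded by blast

  \<comment> \<open>Contains both the points used by the algorithm and those with the exact
    aggregate, so that values of \<open>F i\<close> can be compared on one compact set.\<close>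
  define C where
    "C i = closure (range (\<lambda>k. (x k $ i, u k i))) \<union> (\<lambda>y. (y $ i, agg y)) ` S" for i
  have "compact ((\<lambda>y. (y $ i, agg y)) ` S)" for i
    by (intro compact_continuous_image cont_pair S)
  moreover have "compact (closure (range (\<lambda>k. (x k $ i, u k i))))" for i
  proof -
    obtain B2 where B2: "\<And>y. y \<in> S \<Longrightarrow> norm (y $ i, agg y) \<le> B2"
      using compact_imp_bounded[OF \<open>compact ((\<lambda>y. (y $ i, agg y)) ` S)\<close>] by (auto simp: bounded_iff)
    have "norm (x k $ i, u k i) \<le> B2 + B'" for k
    proof -
      have "(x k $ i, u k i) = (x k $ i, agg (x k)) + (0, tracking_error k i)"
        by (simp add: u_eq)
      then show ?thesis
        using norm_triangle_ineq[of "(x k $ i, agg (x k))" "(0, tracking_error k i)"]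
          B2[OF x_in_S, of k] B'[of k i] by (simp add: norm_Pair)
    qed
    then show ?thesis
      unfolding compact_closure bounded_iff by blast
  qed
  ultimately have C_compact: "compact (C i)" for i
    unfolding C_def by (intro compact_Un)
  \<comment> \<open>Bounded points might still accumulate at the boundary of \<open>D i\<close>;
    well-posedness excludes this.\<close>
  have "C i \<subseteq> D i" for i
    using well_posed pair_in_D by (auto simp: C_def well_posed_run_def u_def)
  then have cont_C: "continuous_on (C i) (F i)" for i
    using continuous_on_subset[OF cont_F] by blast
  have in_C: "(x k $ i, u k i) \<in> C i" "(x k $ i, agg (x k)) \<in> C i" for k i
    using x_in_S closure_subset[of "range (\<lambda>k. (x k $ i, u k i))"] by (auto simp: C_def)

  have "\<exists>M. \<forall>k. norm (G k $ i) \<le> M" for i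
    using compact_imp_bounded[OF compact_continuous_image[OF cont_C C_compact], of i] in_C(1)[of _ i]
    unfolding bounded_iff G_def by auto
  then obtain M where M: "\<And>k i. norm (G k $ i) \<le> M i"
    by metis

  \<comment> \<open>Vanishing increments, tracking errors and gradient errors\<close>
  have \<alpha>_0: "\<alpha> \<longlonglongrightarrow> 0"
    using summable_LIMSEQ_zero[OF steps(4)] by (simp add: power_tendsto_0_iff)
  have "(\<lambda>k. x (Suc k) $ i - x k $ i) \<longlonglongrightarrow> 0" for i
  proof (rule Lim_null_comparison)
    have "norm (x (Suc k) $ i - x k $ i) \<le> \<alpha> k * M i" for k
    proof -
      have "norm (x (Suc k) $ i - x k $ i) \<le> norm ((x k $ i - \<alpha> k *\<^sub>R G k $ i) - x k $ i)"
        unfolding x_Suc[of k] by (intro closest_point_step K closed_K x_in_K)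
      also have "\<dots> = \<alpha> k * norm (G k $ i)"
        using steps(1)[of k] by simp
      also have "\<dots> \<le> \<alpha> k * M i"
        using steps(1)[of k] M by (intro mult_left_mono) auto
      finally show ?thesis .
    qed
    then show "\<forall>\<^sub>F k in sequentially. norm (x (Suc k) $ i - x k $ i) \<le> \<alpha> k * M i"
      by simp
    show "(\<lambda>k. \<alpha> k * M i) \<longlonglongrightarrow> 0"
      by (intro tendsto_mult_left_zero \<alpha>_0)
  qed
  then have tracking_0: "(\<lambda>k. tracking_error k i) \<longlonglongrightarrow> 0" for i
    by (rule tracking_error_tendsto_0)

  define e where "e k = G k - \<phi> (x k)" for k
  have "(\<lambda>k. e k $ i) \<longlonglongrightarrow> 0" for i
  proof -
    \<comment> \<open>The two points differ by the tracking error only; uniform continuity on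
      \<open>C i\<close> carries this over to the values of \<open>F i\<close>.\<close>
    have "(\<lambda>k. dist (x k $ i, u k i) (x k $ i, agg (x k))) \<longlonglongrightarrow> 0"
      using tendsto_norm[OF tracking_0[of i]] by (simp add: dist_Pair_Pair u_eq dist_norm)
    with in_C have "(\<lambda>k. dist (F i (x k $ i, u k i)) (F i (x k $ i, agg (x k)))) \<longlonglongrightarrow> 0"
      by (intro compact_uniformly_continuous[OF cont_C C_compact, of i,
            unfolded uniformly_continuous_on_sequentially, rule_format]) auto
    then have "(\<lambda>k. norm (e k $ i)) \<longlonglongrightarrow> 0"
      by (simp add: e_def G_def \<phi>_nth dist_norm)
    then show ?thesis
      by (rule tendsto_norm_zero_cancel)
  qed
  then have e_0: "e \<longlonglongrightarrow> 0"
    by (auto intro: vec_tendstoI[where f = e])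

  \<comment> \<open>Descent of the squared distance to the solution\<close>
  define r where "r k = (norm (x k - xs))\<^sup>2" for k
  define \<psi> where "\<psi> k = 2 * ((\<phi> (x k) - \<phi> xs) \<bullet> (x k - xs))" for k
  \<comment> \<open>Collects, after division by \<open>\<alpha> k\<close>, the quadratic term of the
    expanded square and the contribution of the gradient error.\<close>
  define \<beta> where "\<beta> k = \<alpha> k * (norm (G k))\<^sup>2 - 2 * (e k \<bullet> (x k - xs))" for k
  have "r \<longlonglongrightarrow> 0"
  proof (rule perturbed_descent_tendsto_0)
    show "r (Suc k) \<le> r k - \<alpha> k * \<psi> k + \<alpha> k * \<beta> k" for k
    proof -
      have "norm (x (Suc k) $ i - xs $ i) \<le> norm (x k $ i - \<alpha> k *\<^sub>R G k $ i - xs $ i)" for i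
        unfolding x_Suc[of k]
        using xs_in_S by (intro closest_point_step K closed_K) (auto simp: S_def profiles_def)
      then have "norm (x (Suc k) - xs) \<le> norm (x k - \<alpha> k *\<^sub>R G k - xs)"
        by (auto intro: norm_le_componentwise_cart[of "x (Suc k) - xs"])
      then have "r (Suc k) \<le> (norm ((x k - xs) - \<alpha> k *\<^sub>R G k))\<^sup>2"
        unfolding r_def by (intro power_mono) (auto simp: algebra_simps)
      also have "\<dots> = r k - 2 * \<alpha> k * (G k \<bullet> (x k - xs)) + \<alpha> k * (\<alpha> k * (norm (G k))\<^sup>2)"
        unfolding r_def power2_norm_eq_inner
        by (simp add: inner_diff_left inner_diff_right inner_commute algebra_simps)
      \<comment> \<open>The last summand is nonnegative because \<open>xs\<close> solves the
        variational inequality, and is dropped below.\<close>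
      also have "G k \<bullet> (x k - xs) = (\<phi> (x k) - \<phi> xs) \<bullet> (x k - xs) + e k \<bullet> (x k - xs) + (x k - xs) \<bullet> \<phi> xs"
        by (simp add: e_def inner_diff_left inner_diff_right inner_commute)
      also have "r k - 2 * \<alpha> k * \<dots> + \<alpha> k * (\<alpha> k * (norm (G k))\<^sup>2)
          = r k - \<alpha> k * \<psi> k + \<alpha> k * \<beta> k - 2 * (\<alpha> k * ((x k - xs) \<bullet> \<phi> xs))"
        by (simp add: \<psi>_def \<beta>_def algebra_simps)
      also have "\<dots> \<le> r k - \<alpha> k * \<psi> k + \<alpha> k * \<beta> k"
        using xs x_in_S[of k] steps(1)[of k] by (simp add: solves_VI_def)
      finally show ?thesis .
    qed
    show "r k \<ge> 0" for k
      by (simp add: r_def)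
    show "\<psi> k \<ge> 0" for k
      using mono' x_in_S[of k] xs_in_S unfolding \<psi>_def strictly_monotone_over_def
      by (cases "x k = xs") (auto intro: less_imp_le)
    show "\<exists>c>0. \<forall>k. r k \<ge> \<epsilon> \<longrightarrow> \<psi> k \<ge> c" if \<epsilon>: "\<epsilon> > 0" for \<epsilon>
    proof -
      obtain c where "c > 0"
        "\<And>y. y \<in> S \<Longrightarrow> \<epsilon> \<le> (norm (y - xs))\<^sup>2 \<Longrightarrow> c \<le> (\<phi> y - \<phi> xs) \<bullet> (y - xs)"
        using strictly_monotone_gap[OF S(1) cont_\<phi> mono' xs_in_S \<epsilon>] by blast
      then show ?thesis
        by (intro exI[of _ "2 * c"]) (auto simp: r_def \<psi>_def x_in_S)
    qed
    show "\<beta> \<longlonglongrightarrow> 0"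
    proof -
      have "norm (G k) \<le> (\<Sum>i\<in>UNIV. M i)" for k
        by (intro order_trans[OF norm_le_sum_norm_nth] sum_mono M)
      then have "norm (\<alpha> k * (norm (G k))\<^sup>2) \<le> \<alpha> k * (\<Sum>i\<in>UNIV. M i)\<^sup>2" for k
        using steps(1)[of k] by (simp add: abs_mult power_mono)
      then have "\<forall>\<^sub>F k in sequentially. norm (\<alpha> k * (norm (G k))\<^sup>2) \<le> \<alpha> k * (\<Sum>i\<in>UNIV. M i)\<^sup>2"
        by (intro always_eventually allI)
      then have "(\<lambda>k. \<alpha> k * (norm (G k))\<^sup>2) \<longlonglongrightarrow> 0"
        using tendsto_mult_left_zero[OF \<alpha>_0] by (rule Lim_null_comparison)
      moreover have "norm (e k \<bullet> (x k - xs)) \<le> norm (e k) * (2 * B)" for k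
      proof -
        have "norm (e k \<bullet> (x k - xs)) \<le> norm (e k) * norm (x k - xs)"
          using Cauchy_Schwarz_ineq2[of "e k" "x k - xs"] by simp
        also have "\<dots> \<le> norm (e k) * (2 * B)"
          by (intro mult_left_mono diff_le x_in_S xs_in_S norm_ge_zero)
        finally show ?thesis .
      qed
      then have "\<forall>\<^sub>F k in sequentially. norm (e k \<bullet> (x k - xs)) \<le> norm (e k) * (2 * B)"
        by (intro always_eventually allI)
      then have "(\<lambda>k. e k \<bullet> (x k - xs)) \<longlonglongrightarrow> 0"
        using tendsto_mult_left_zero[OF tendsto_norm_zero[OF e_0]] by (rule Lim_null_comparison)
      ultimately have "\<beta> \<longlonglongrightarrow> 0 - 2 * 0"
        unfolding \<beta>_def by (intro tendsto_diff tendsto_mult tendsto_const)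
      then show ?thesis
        by simp
    qed
  qed (use steps \<alpha>_0 in auto)
  then have "(\<lambda>k. norm (x k - xs)) \<longlonglongrightarrow> 0"
    by (simp add: r_def[abs_def] power_tendsto_0_iff)
  then have lim: "x \<longlonglongrightarrow> xs"
    by (rule LIM_zero_cancel[OF tendsto_norm_zero_cancel])
  show ?thesis
    unfolding S_def[symmetric] \<phi>_def[symmetric]
  proof (intro exI conjI allI impI)
    show "solves_VI S \<phi> xs" by (rule xs)
    show "y = xs" if "solves_VI S \<phi> y" for y
      using mono' that xs by (rule solves_VI_unique)
    show "x \<longlonglongrightarrow> xs" by (rule lim)
  qed
qed

end
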